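(* Every solution $(s(t),v(t))\in\Omega_S$ of the open-road closed-loop system described in the context satisfies, for all $t\ge 0$ and $i=2,\dots,n$, $$s_i(t)\le\max(s_i(0),\lambda)+\frac{v_{\max}\sqrt{2H_S(s(0),v(0))}}{2\mu\min(v^*,v_{\max}-v^* )}.$$
   Context: Constants: integer $n\ge 2$; $\lambda>L>0$; $v_{\max}>0$; $v^*\in(0,v_{\max})$; $\mu>0$; $\mathbb{R}_+=[0,+\infty)$. Functions: $V\in C^3((L,+\infty);\mathbb{R}_+)$ satisfies $\lim_{x\to L^+}V(x)=+\infty$, $V(x)=0$ for $x\ge\lambda$, and $V'(x)<0$, $V''(x)>0$ for $x\in(L,\lambda)$. $b:\mathbb{R}\to(v^*-v_{\max},v^* )$ is $C^2$ and increasing, with $b(0)=0$, $xb(x)>0$ for $x\ne 0$, and $b'(0)>0$. State: $s=(s_2,\dots,s_n)\in\mathbb{R}^{n-1}$, $v=(v_1,\dots,v_n)\in\mathbb{R}^n$, with the convention $s_1=s_{n+1}=+\infty$ and $V'(s_1)=V''(s_1)=V'(s_{n+1})=V''(s_{n+1})=0$ (so terms involving $v_0$ or $v_{n+1}$ below are multiplied by zero and vanish). State space (open set): $$\Omega_S=\Big\{(s,v)\in\mathbb{R}^{2n-1}:\ \min_{i=2,\dots,n}s_i>L,\ \max_{i=1,\dots,n}v_i<v_{\max},\ \min_{i=1,\dots,n}v_i>0\Big\}.$$ Define, for $i=1,\dots,n$, $$f_i(s)=v^*-b\big(V'(s_{i+1})-V'(s_i)\big),$$ $$Z_i(s,v)=-v_{\max}^2\,b'\big(V'(s_{i+1})-V'(s_i)\big)\big(V''(s_{i+1})(v_i-v_{i+1})-V''(s_i)(v_{i-1}-v_i)\big),$$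 and for $w,y\in(0,v_{\max})$ $$\beta(w,y)=\frac{v_{\max}^3(w+y)-2v_{\max}^2yw}{2(v_{\max}-w)^2w^2}\ (>0).$$ The open-road closed-loop system on $\Omega_S$ is $$\dot{s}_i=v_{i-1}-v_i,\ i=2,\dots,n,\qquad \dot{v}_i=F_i,\ i=1,\dots,n,$$ $$F_i=\frac{1}{\beta(v_i,f_i(s))}\left(\frac{Z_i(s,v)-\mu v_{\max}^2(v_i-f_i(s))}{v_i(v_{\max}-v_i)}+V'(s_i)-V'(s_{i+1})\right).$$ The function $H_S:\Omega_S\to\mathbb{R}_+$ is $$H_S(s,v)=\frac{v_{\max}^2}{2}\sum_{i=1}^n\frac{(v_i-f_i(s))^2}{v_i(v_{\max}-v_i)}+\sum_{i=2}^nV(s_i).$$ *)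

theory Defs
  imports "HOL-Analysis.Analysis"
begin

definition Ck_on :: "nat \<Rightarrow> (real \<Rightarrow> real) \<Rightarrow> real set \<Rightarrow> bool" where
  \<comment> \<open>Intended for open \<open>S\<close>, where the two-sided derivatives depend only on the values of \<open>f\<close> in \<open>S\<close>.\<close>
  "Ck_on k f S \<longleftrightarrow>
     (\<forall>j<k. (deriv ^^ j) f differentiable_on S) \<and> (\<forall>j\<le>k. continuous_on S ((deriv ^^ j) f))"

text \<open>
  A state consists of the spacings \<open>s 2, \<dots>, s n\<close> and the speeds \<open>v 1, \<dots>, v n\<close>; the values of
  \<open>s\<close> and \<open>v\<close> at all other indices are irrelevant. The convention
  \<open>s\<^sub>1 = s\<^sub>n\<^sub>+\<^sub>1 = \<infinity>\<close>, under which the derivatives of \<open>V\<close> vanish at these two spacings,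
  is built into \<open>dV\<close> and \<open>ddV\<close>. In \<open>Z_S\<close> the values \<open>v 0\<close> and \<open>v (n + 1)\<close> therefore occur only
  multiplied by \<open>0\<close>.
\<close>

definition dV :: "nat \<Rightarrow> (real \<Rightarrow> real) \<Rightarrow> (nat \<Rightarrow> real) \<Rightarrow> nat \<Rightarrow> real" where
  "dV n V s i = (if i \<in> {2..n} then deriv V (s i) else 0)"

definition ddV :: "nat \<Rightarrow> (real \<Rightarrow> real) \<Rightarrow> (nat \<Rightarrow> real) \<Rightarrow> nat \<Rightarrow> real" where
  "ddV n V s i = (if i \<in> {2..n} then deriv (deriv V) (s i) else 0)"

definition Omega :: "nat \<Rightarrow> real \<Rightarrow> real \<Rightarrow> ((nat \<Rightarrow> real) \<times> (nat \<Rightarrow> real)) set" where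
  "Omega n L vmax = {(s, v). (\<forall>i\<in>{2..n}. L < s i) \<and> (\<forall>i\<in>{1..n}. 0 < v i \<and> v i < vmax)}"

definition f_S :: "nat \<Rightarrow> (real \<Rightarrow> real) \<Rightarrow> (real \<Rightarrow> real) \<Rightarrow> real \<Rightarrow> (nat \<Rightarrow> real) \<Rightarrow> nat \<Rightarrow> real" where
  "f_S n V b vstar s i = vstar - b (dV n V s (i + 1) - dV n V s i)"

definition Z_S :: "nat \<Rightarrow> (real \<Rightarrow> real) \<Rightarrow> (real \<Rightarrow> real) \<Rightarrow> real \<Rightarrow>
    (nat \<Rightarrow> real) \<Rightarrow> (nat \<Rightarrow> real) \<Rightarrow> nat \<Rightarrow> real" where
  "Z_S n V b vmax s v i =
     - vmax\<^sup>2 * deriv b (dV n V s (i + 1) - dV n V s i) *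
       (ddV n V s (i + 1) * (v i - v (i + 1)) - ddV n V s i * (v (i - 1) - v i))"

definition beta :: "real \<Rightarrow> real \<Rightarrow> real \<Rightarrow> real" where
  "beta vmax w y =
     (vmax ^ 3 * (w + y) - 2 * vmax\<^sup>2 * y * w) / (2 * (vmax - w)\<^sup>2 * w\<^sup>2)"

definition F_S :: "nat \<Rightarrow> (real \<Rightarrow> real) \<Rightarrow> (real \<Rightarrow> real) \<Rightarrow> real \<Rightarrow> real \<Rightarrow> real \<Rightarrow>
    (nat \<Rightarrow> real) \<Rightarrow> (nat \<Rightarrow> real) \<Rightarrow> nat \<Rightarrow> real" where
  "F_S n V b vstar vmax \<mu> s v i =
     1 / beta vmax (v i) (f_S n V b vstar s i) *
       ((Z_S n V b vmax s v i - \<mu> * vmax\<^sup>2 * (v i - f_S n V b vstar s i)) / (v i * (vmax - v i))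
        + dV n V s i - dV n V s (i + 1))"

definition H_S :: "nat \<Rightarrow> (real \<Rightarrow> real) \<Rightarrow> (real \<Rightarrow> real) \<Rightarrow> real \<Rightarrow> real \<Rightarrow>
    (nat \<Rightarrow> real) \<Rightarrow> (nat \<Rightarrow> real) \<Rightarrow> real" where
  "H_S n V b vstar vmax s v =
     vmax\<^sup>2 / 2 * (\<Sum>i=1..n. (v i - f_S n V b vstar s i)\<^sup>2 / (v i * (vmax - v i)))
     + (\<Sum>i=2..n. V (s i))"

definition open_road_solution :: "nat \<Rightarrow> real \<Rightarrow> (real \<Rightarrow> real) \<Rightarrow> (real \<Rightarrow> real) \<Rightarrow> real \<Rightarrow> real \<Rightarrow> real \<Rightarrow>
    real set \<Rightarrow> (real \<Rightarrow> nat \<Rightarrow> real) \<Rightarrow> (real \<Rightarrow> nat \<Rightarrow> real) \<Rightarrow> bool" where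
  "open_road_solution n L V b vstar vmax \<mu> J s v \<longleftrightarrow>
     (\<forall>t\<in>J. (s t, v t) \<in> Omega n L vmax \<and>
       (\<forall>i\<in>{2..n}. ((\<lambda>\<tau>. s \<tau> i) has_real_derivative v t (i - 1) - v t i) (at t within J)) \<and>
       (\<forall>i\<in>{1..n}. ((\<lambda>\<tau>. v \<tau> i) has_real_derivative F_S n V b vstar vmax \<mu> (s t) (v t) i)
          (at t within J)))"

end

theory Submission
  imports Defs
begin

text \<open>
  Write \<open>\<phi>\<^sub>i = (v\<^sub>i - f\<^sub>i) / sqrt (v\<^sub>i (vmax - v\<^sub>i))\<close> for the normalised deviation of the speed of
  vehicle \<open>i\<close> from its reference speed \<open>f\<^sub>i\<close>. The factor \<open>1 / \<beta>\<close> and the term \<open>Z\<^sub>i\<close> of the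
  feedback law are designed so that \<open>\<phi>\<^sub>i\<close> satisfies the scalar equation
  \<open>\<phi>\<^sub>i' = - \<mu> \<phi>\<^sub>i + sqrt (v\<^sub>i (vmax - v\<^sub>i)) (V' (s\<^sub>i) - V' (s\<^sub>i\<^sub>+\<^sub>1)) / vmax\<^sup>2\<close>
  (lemma \<open>deviation_has_derivative\<close>). Two consequences carry the proof.

  First, \<open>H_S = vmax\<^sup>2 / 2 * (\<Sum>i. \<phi>\<^sub>i\<^sup>2) + (\<Sum>i. V (s\<^sub>i))\<close> does not increase along solutions
  (lemma \<open>energy_antimono\<close>): the potential forces cancel by summation by parts, and only dissipative
  terms remain. Hence every \<open>\<bar>\<phi>\<^sub>j\<bar>\<close> is at all times at most \<open>C = sqrt (2 H_S (0)) / vmax\<close>.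

  Secondly, while \<open>s\<^sub>i \<ge> lam\<close> the vehicles \<open>i - 1\<close> and \<open>i\<close> do not interact, as \<open>V' (s\<^sub>i) = 0\<close>.
  Vehicle \<open>i - 1\<close> can then only be repelled by its predecessor, and vehicle \<open>i\<close> only by its
  follower. So \<open>f\<^sub>i\<^sub>-\<^sub>1 \<le> vstar \<le> f\<^sub>i\<close>, \<open>\<phi>\<^sub>i\<^sub>-\<^sub>1' \<le> - \<mu> \<phi>\<^sub>i\<^sub>-\<^sub>1\<close> and
  \<open>\<phi>\<^sub>i' \<ge> - \<mu> \<phi>\<^sub>i\<close>. If this phase starts at time \<open>a\<close>, then
  \<open>s\<^sub>i' \<le> (v\<^sub>i\<^sub>-\<^sub>1 - f\<^sub>i\<^sub>-\<^sub>1) - (v\<^sub>i - f\<^sub>i) \<le> vmax / 2 * 2 C exp (- \<mu> (t - a))\<close>, because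
  \<open>sqrt (v (vmax - v)) \<le> vmax / 2\<close>. Integration gives a total gain of at most
  \<open>vmax C / \<mu> = sqrt (2 H_S (0)) / \<mu>\<close> over the value at the start of the phase, which is at most
  \<open>max (s\<^sub>i (0)) lam\<close> when \<open>a\<close> is the last earlier time with \<open>s\<^sub>i \<le> lam\<close>, or \<open>0\<close>.
  As \<open>min vstar (vmax - vstar) \<le> vmax / 2\<close>, this implies the asserted bound.
\<close>

section \<open>Preliminaries from calculus\<close>

lemma nonincreasing_from_deriv_nonpos:
  fixes f f' :: "real \<Rightarrow> real"
  assumes "a \<le> b"
    and deriv: "\<And>x. x \<in> {a..b} \<Longrightarrow> (f has_real_derivative f' x) (at x within {a..b})"
    and nonpos: "\<And>x. a < x \<Longrightarrow> x < b \<Longrightarrow> f' x \<le> 0"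
  shows "f b \<le> f a"
proof (cases "a = b")
  case False
  with \<open>a \<le> b\<close> have "a < b" by simp
  moreover have "(f has_derivative (*) (f' x)) (at x within {a..b})" if "a \<le> x" "x \<le> b" for x
    using deriv[of x] that by (simp add: has_field_derivative_def)
  ultimately obtain x where x: "x \<in> {a<..<b}" "f b - f a = f' x * (b - a)"
    using mvt_simple[of a b f "\<lambda>x. (*) (f' x)"] by blast
  moreover have "f' x * (b - a) \<le> 0"
    using x(1) nonpos[of x] by (simp add: mult_nonpos_nonneg)
  ultimately show ?thesis by simp
qed simp

text \<open>A scalar Gronwall inequality: \<open>x \<mapsto> exp (\<mu> (x - a)) * y x\<close> does not increase.\<close>

lemma exponential_decay:
  fixes y y' :: "real \<Rightarrow> real"
  assumes "a \<le> b"
    and deriv: "\<And>x. x \<in> {a..b} \<Longrightarrow> (y has_real_derivative y' x) (at x within {a..b})"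
    and decay: "\<And>x. a < x \<Longrightarrow> x < b \<Longrightarrow> y' x \<le> - \<mu> * y x"
  shows "y b \<le> exp (- \<mu> * (b - a)) * y a"
proof -
  have "exp (\<mu> * (b - a)) * y b \<le> exp (\<mu> * (a - a)) * y a"
  proof (rule nonincreasing_from_deriv_nonpos[OF \<open>a \<le> b\<close>])
    show "((\<lambda>x. exp (\<mu> * (x - a)) * y x) has_real_derivative
        exp (\<mu> * (x - a)) * (\<mu> * y x + y' x)) (at x within {a..b})" if "x \<in> {a..b}" for x
      using deriv[OF that] by (auto intro!: derivative_eq_intros simp: algebra_simps)
    show "exp (\<mu> * (x - a)) * (\<mu> * y x + y' x) \<le> 0" if "a < x" "x < b" for x
      using decay[OF that] by (intro mult_nonneg_nonpos) auto
  qed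
  hence "exp (- \<mu> * (b - a)) * (exp (\<mu> * (b - a)) * y b) \<le> exp (- \<mu> * (b - a)) * y a"
    by simp
  thus ?thesis
    by (simp add: mult.assoc[symmetric] exp_add[symmetric])
qed

text \<open>
  The summation by parts behind the cancellation of the potential forces; applied to a constant
  sequence \<open>v\<close>, it also says that the forces sum to zero.
\<close>

lemma summation_by_parts_from_zero:
  fixes a v :: "nat \<Rightarrow> real"
  assumes "a 1 = 0"
  shows "(\<Sum>i=2..n. a i * (v (i - 1) - v i)) + v n * a (n + 1) = (\<Sum>i=1..n. v i * (a (i + 1) - a i))"
proof (induction n)
  case 0
  then show ?case using assms by simp
next
  case (Suc n)
  then show ?case using assms by (cases n) (auto simp: algebra_simps)
qed

text \<open>
  This is the weight that turns a normalised deviation back into a speed, so a bound on deviations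
  gives a bound on relative speeds.
\<close>

lemma sqrt_mult_diff_le_half:
  fixes v vmax :: real
  assumes "0 < vmax"
  shows "sqrt (v * (vmax - v)) \<le> vmax / 2"
proof (rule real_le_lsqrt)
  have "0 \<le> (vmax / 2 - v)\<^sup>2" by simp
  thus "v * (vmax - v) \<le> (vmax / 2)\<^sup>2" by (simp add: power2_eq_square algebra_simps)
qed (use assms in simp)

section \<open>The speed deviations\<close>

definition deviation :: "real \<Rightarrow> real \<Rightarrow> real \<Rightarrow> real" where
  "deviation vmax w y = (w - y) / sqrt (w * (vmax - w))"

lemma beta_pos:
  assumes "0 < vmax" "0 < w" "w < vmax" "0 < y" "y < vmax"
  shows "0 < beta vmax w y"
proof -
  have "vmax ^ 3 * (w + y) - 2 * vmax\<^sup>2 * y * w = vmax\<^sup>2 * (w * (vmax - y) + y * (vmax - w))"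
    by (simp add: power2_eq_square power3_eq_cube algebra_simps)
  thus ?thesis
    using assms by (auto simp: beta_def intro!: divide_pos_pos mult_pos_pos add_pos_pos)
qed

text \<open>
  The origin of \<open>\<beta>\<close>: up to the factor \<open>sqrt (w (vmax - w)) / vmax\<^sup>2\<close> it is the partial derivative
  of the deviation with respect to the speed.
\<close>

lemma deviation_chain_rule:
  assumes vm: "0 < vmax" and w: "0 < w t" "w t < vmax"
    and dw: "(w has_real_derivative w') (at t within S)"
    and dy: "(y has_real_derivative y') (at t within S)"
  shows "((\<lambda>\<tau>. deviation vmax (w \<tau>) (y \<tau>)) has_real_derivative
      sqrt (w t * (vmax - w t)) * beta vmax (w t) (y t) * w' / vmax\<^sup>2
        - y' / sqrt (w t * (vmax - w t))) (at t within S)"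
proof -
  define g where "g = sqrt (w t * (vmax - w t))"
  have gpos: "0 < g" and gsq: "g * g = w t * (vmax - w t)"
    using w by (auto simp: g_def)
  have beta_g: "beta vmax (w t) (y t) = vmax\<^sup>2 * (vmax * (w t + y t) - 2 * y t * w t) / (2 * (g * g)\<^sup>2)"
    unfolding beta_def gsq
    by (simp add: power2_eq_square power3_eq_cube algebra_simps)
  have dg: "((\<lambda>\<tau>. sqrt (w \<tau> * (vmax - w \<tau>))) has_real_derivative
      (w' * (vmax - 2 * w t)) / (2 * g)) (at t within S)"
    using w unfolding g_def
    by (auto intro!: derivative_eq_intros dw simp: field_simps)
  have "((\<lambda>\<tau>. deviation vmax (w \<tau>) (y \<tau>)) has_real_derivative
      ((w' - y') * g - (w t - y t) * ((w' * (vmax - 2 * w t)) / (2 * g))) / (g * g)) (at t within S)"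
    unfolding deviation_def
    using DERIV_divide[OF DERIV_diff[OF dw dy] dg] gpos by (simp add: g_def[symmetric])
  moreover have "((w' - y') * g - (w t - y t) * ((w' * (vmax - 2 * w t)) / (2 * g))) / (g * g)
      = w' * (2 * (g * g) - (w t - y t) * (vmax - 2 * w t)) / (2 * g ^ 3) - y' / g"
    using gpos by (simp add: field_simps power3_eq_cube)
  moreover have "2 * (g * g) - (w t - y t) * (vmax - 2 * w t) = vmax * (w t + y t) - 2 * y t * w t"
    unfolding gsq by (simp add: algebra_simps)
  moreover have "w' * (vmax * (w t + y t) - 2 * y t * w t) / (2 * g ^ 3)
      = g * beta vmax (w t) (y t) * w' / vmax\<^sup>2"
    unfolding beta_g using gpos vm by (simp add: field_simps power2_eq_square power3_eq_cube)
  ultimately show ?thesis unfolding g_def[symmetric] by simp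
qed

section \<open>Solutions of the closed-loop system\<close>

locale open_road =
  fixes n :: nat and L lam vmax vstar \<mu> :: real
    and V b :: "real \<Rightarrow> real" and J :: "real set" and s v :: "real \<Rightarrow> nat \<Rightarrow> real"
  assumes L_less_lam: "L < lam" and vmax_pos: "0 < vmax" and mu_pos: "0 < \<mu>"
    and V_smooth: "Ck_on 2 V {L<..}" and V_nonneg: "\<And>x. L < x \<Longrightarrow> 0 \<le> V x"
    and V_zero: "\<And>x. lam \<le> x \<Longrightarrow> V x = 0"
    and V_decreasing: "\<And>x. L < x \<Longrightarrow> x < lam \<Longrightarrow> deriv V x < 0"
    and b_differentiable: "\<And>x. b differentiable at x"
    and b_range: "\<And>x. b x \<in> {vstar - vmax<..<vstar}" and b_mono: "mono b" and b_0: "b 0 = 0"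
    and J_interval: "is_interval J" and J_0: "0 \<in> J" and J_nonneg: "J \<subseteq> {0..}"
    and solution: "open_road_solution n L V b vstar vmax \<mu> J s v"
begin

abbreviation f :: "real \<Rightarrow> nat \<Rightarrow> real" where
  "f t i \<equiv> f_S n V b vstar (s t) i"

abbreviation force :: "real \<Rightarrow> nat \<Rightarrow> real" where
  "force t i \<equiv> dV n V (s t) i"

abbreviation \<phi> :: "real \<Rightarrow> nat \<Rightarrow> real" where
  "\<phi> t i \<equiv> deviation vmax (v t i) (f t i)"

abbreviation energy :: "real \<Rightarrow> real" where
  "energy t \<equiv> H_S n V b vstar vmax (s t) (v t)"

lemma deriv_V_iterate_has_derivative:
  assumes "j < 2" "L < x"
  shows "((deriv ^^ j) V has_real_derivative (deriv ^^ Suc j) V x) (at x)"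
proof -
  have "(deriv ^^ j) V differentiable at x within {L<..}"
    using V_smooth assms unfolding Ck_on_def differentiable_on_def by auto
  hence "(deriv ^^ j) V differentiable at x"
    using assms(2) at_within_open[of x "{L<..}"] by simp
  thus ?thesis
    by (simp add: DERIV_deriv_iff_real_differentiable)
qed

lemmas V_has_derivative = deriv_V_iterate_has_derivative[of 0, simplified]
lemmas deriv_V_has_derivative = deriv_V_iterate_has_derivative[of 1, simplified]

text \<open>Beyond \<open>lam\<close> every point, \<open>lam\<close> included, is a minimum of \<open>V\<close>.\<close>

lemma deriv_V_zero:
  assumes "lam \<le> x"
  shows "deriv V x = 0"
proof (rule DERIV_local_min)
  show "DERIV V x :> deriv V x" "0 < x - L"
    using assms L_less_lam V_has_derivative by auto
  show "\<forall>y. \<bar>x - y\<bar> < x - L \<longrightarrow> V x \<le> V y"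
    using assms V_zero V_nonneg by auto
qed

lemma deriv_V_nonpos: "L < x \<Longrightarrow> deriv V x \<le> 0"
  using V_decreasing[of x] deriv_V_zero[of x] by (cases "x < lam") auto

lemma spacing_gt: "t \<in> J \<Longrightarrow> i \<in> {2..n} \<Longrightarrow> L < s t i"
  and speed_pos: "t \<in> J \<Longrightarrow> i \<in> {1..n} \<Longrightarrow> 0 < v t i"
  and speed_less: "t \<in> J \<Longrightarrow> i \<in> {1..n} \<Longrightarrow> v t i < vmax"
  using solution by (auto simp: open_road_solution_def Omega_def)

lemma spacing_has_derivative:
  "t \<in> J \<Longrightarrow> i \<in> {2..n} \<Longrightarrow>
    ((\<lambda>\<tau>. s \<tau> i) has_real_derivative v t (i - 1) - v t i) (at t within J)"
  and speed_has_derivative: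
  "t \<in> J \<Longrightarrow> i \<in> {1..n} \<Longrightarrow>
    ((\<lambda>\<tau>. v \<tau> i) has_real_derivative F_S n V b vstar vmax \<mu> (s t) (v t) i) (at t within J)"
  using solution by (auto simp: open_road_solution_def)

lemma subinterval: "a \<in> J \<Longrightarrow> c \<in> J \<Longrightarrow> {a..c} \<subseteq> J"
  using J_interval by (meson atLeastAtMost_iff mem_is_interval_1_I subsetI)

lemma f_pos: "0 < f t i" and f_less: "f t i < vmax"
  using b_range by (auto simp: f_S_def algebra_simps)

lemma b_nonneg: "0 \<le> x \<Longrightarrow> 0 \<le> b x" and b_nonpos: "x \<le> 0 \<Longrightarrow> b x \<le> 0"
  using b_mono b_0 by (metis monoD)+

lemma force_nonpos: "t \<in> J \<Longrightarrow> force t i \<le> 0"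
  using deriv_V_nonpos spacing_gt by (simp add: dV_def)

lemma force_has_derivative:
  assumes "t \<in> J"
  shows "((\<lambda>\<tau>. force \<tau> i) has_real_derivative ddV n V (s t) i * (v t (i - 1) - v t i)) (at t within J)"
proof (cases "i \<in> {2..n}")
  case True
  show ?thesis
    using DERIV_chain2[OF deriv_V_has_derivative spacing_has_derivative[OF assms True]]
      spacing_gt[OF assms True] True
    by (simp add: dV_def ddV_def)
qed (auto simp: dV_def ddV_def)

text \<open>In control terms, \<open>Z\<^sub>i\<close> is the feedforward term that makes the acceleration track the reference speed.\<close>

lemma f_has_derivative:
  assumes "t \<in> J"
  shows "((\<lambda>\<tau>. f \<tau> i) has_real_derivative Z_S n V b vmax (s t) (v t) i / vmax\<^sup>2) (at t within J)"
proof -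
  let ?x = "\<lambda>\<tau>. force \<tau> (i + 1) - force \<tau> i"
  have "(?x has_real_derivative ddV n V (s t) (i + 1) * (v t i - v t (i + 1))
      - ddV n V (s t) i * (v t (i - 1) - v t i)) (at t within J)" (is "(_ has_real_derivative ?x') _")
    using DERIV_diff[OF force_has_derivative[OF assms, of "i + 1"] force_has_derivative[OF assms, of i]]
    by simp
  moreover have "(b has_real_derivative deriv b (?x t)) (at (?x t))"
    using b_differentiable by (simp add: DERIV_deriv_iff_real_differentiable)
  ultimately have "((\<lambda>\<tau>. b (?x \<tau>)) has_real_derivative deriv b (?x t) * ?x') (at t within J)"
    by (rule DERIV_chain2[rotated])
  hence "((\<lambda>\<tau>. f \<tau> i) has_real_derivative - (deriv b (?x t) * ?x')) (at t within J)"
    unfolding f_S_def by (auto intro!: derivative_eq_intros)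
  moreover have "Z_S n V b vmax (s t) (v t) i / vmax\<^sup>2 = - (deriv b (?x t) * ?x')"
    using vmax_pos by (simp add: Z_S_def)
  ultimately show ?thesis by simp
qed

text \<open>
  In \<open>\<phi>\<close> the closed loop is linear up to the potential forces: the factor \<open>\<beta>\<close> from the chain rule
  cancels the gain of the controller, and \<open>Z\<^sub>i\<close> cancels the derivative of \<open>f\<^sub>i\<close>.
\<close>

lemma deviation_has_derivative:
  assumes t: "t \<in> J" and i: "i \<in> {1..n}"
  shows "((\<lambda>\<tau>. \<phi> \<tau> i) has_real_derivative
    - \<mu> * \<phi> t i + sqrt (v t i * (vmax - v t i)) * (force t i - force t (i + 1)) / vmax\<^sup>2) (at t within J)"
proof -
  note v = speed_pos[OF t i] speed_less[OF t i]
  define g where "g = sqrt (v t i * (vmax - v t i))"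
  have gpos: "0 < g" and gsq: "v t i * (vmax - v t i) = g * g"
    using v by (auto simp: g_def)
  let ?F = "F_S n V b vstar vmax \<mu> (s t) (v t) i" and ?Z = "Z_S n V b vmax (s t) (v t) i"
  have "0 < beta vmax (v t i) (f t i)"
    using beta_pos vmax_pos v f_pos f_less by blast
  hence betaF: "beta vmax (v t i) (f t i) * ?F
      = (?Z - \<mu> * vmax\<^sup>2 * (v t i - f t i)) / (g * g) + force t i - force t (i + 1)"
    by (simp add: F_S_def gsq)
  have "g * beta vmax (v t i) (f t i) * ?F / vmax\<^sup>2 - ?Z / vmax\<^sup>2 / g
      = g * ((?Z - \<mu> * vmax\<^sup>2 * (v t i - f t i)) / (g * g) + force t i - force t (i + 1)) / vmax\<^sup>2
        - ?Z / vmax\<^sup>2 / g"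
    by (simp only: betaF mult.assoc)
  also have "\<dots> = - \<mu> * ((v t i - f t i) / g) + g * (force t i - force t (i + 1)) / vmax\<^sup>2"
    using gpos vmax_pos by (simp add: field_simps)
  finally show ?thesis
    using deviation_chain_rule[OF vmax_pos v speed_has_derivative[OF t i] f_has_derivative[OF t, of i]]
    by (simp add: deviation_def g_def)
qed

lemma speed_eq_deviation:
  assumes "t \<in> J" "i \<in> {1..n}"
  shows "v t i - f t i = sqrt (v t i * (vmax - v t i)) * \<phi> t i"
  using speed_pos[OF assms] speed_less[OF assms] by (simp add: deviation_def)

section \<open>Dissipation of energy\<close>

lemma energy_eq_deviations:
  assumes "t \<in> J"
  shows "energy t = vmax\<^sup>2 / 2 * (\<Sum>i=1..n. (\<phi> t i)\<^sup>2) + (\<Sum>i=2..n. V (s t i))"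
proof -
  have "(v t i - f t i)\<^sup>2 / (v t i * (vmax - v t i)) = (\<phi> t i)\<^sup>2" if "i \<in> {1..n}" for i
    using speed_pos[OF assms that] speed_less[OF assms that]
    by (simp add: deviation_def power_divide)
  thus ?thesis by (simp add: H_S_def)
qed

text \<open>
  With \<open>x\<^sub>i = V' (s\<^sub>i\<^sub>+\<^sub>1) - V' (s\<^sub>i)\<close>, the kinetic part contributes \<open>- (v\<^sub>i - f\<^sub>i) x\<^sub>i\<close> and the
  potential part, summed by parts, \<open>v\<^sub>i x\<^sub>i\<close>. This leaves \<open>f\<^sub>i x\<^sub>i = vstar x\<^sub>i - b (x\<^sub>i) x\<^sub>i\<close>,
  where the first terms sum to zero. As \<open>b (x)\<close> has the sign of \<open>x\<close>, both remaining sums dissipate.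
\<close>

lemma energy_has_derivative:
  assumes t: "t \<in> J"
  shows "(energy has_real_derivative
    - \<mu> * vmax\<^sup>2 * (\<Sum>i=1..n. (\<phi> t i)\<^sup>2)
      - (\<Sum>i=1..n. b (force t (i + 1) - force t i) * (force t (i + 1) - force t i))) (at t within J)"
    (is "(_ has_real_derivative ?E) _")
proof -
  let ?g = "\<lambda>i. sqrt (v t i * (vmax - v t i))"
  let ?\<phi>' = "\<lambda>i. - \<mu> * \<phi> t i + ?g i * (force t i - force t (i + 1)) / vmax\<^sup>2"
  let ?x = "\<lambda>i. force t (i + 1) - force t i"
  let ?D = "vmax\<^sup>2 / 2 * (\<Sum>i=1..n. 2 * \<phi> t i * ?\<phi>' i) + (\<Sum>i=2..n. force t i * (v t (i - 1) - v t i))"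
  have kinetic: "((\<lambda>\<tau>. (\<phi> \<tau> i)\<^sup>2) has_real_derivative 2 * \<phi> t i * ?\<phi>' i) (at t within J)"
    if "i \<in> {1..n}" for i
    using DERIV_power[OF deviation_has_derivative[OF t that], of 2] by (simp add: mult_ac)
  have potential: "((\<lambda>\<tau>. V (s \<tau> i)) has_real_derivative force t i * (v t (i - 1) - v t i)) (at t within J)"
    if "i \<in> {2..n}" for i
    using DERIV_chain2[OF V_has_derivative spacing_has_derivative[OF t that]] spacing_gt[OF t that] that
    by (simp add: dV_def)
  have "((\<lambda>\<tau>. vmax\<^sup>2 / 2 * (\<Sum>i=1..n. (\<phi> \<tau> i)\<^sup>2) + (\<Sum>i=2..n. V (s \<tau> i))) has_real_derivative ?D) (at t within J)"
    by (intro DERIV_add DERIV_cmult DERIV_sum kinetic potential)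
  hence derivative: "(energy has_real_derivative ?D) (at t within J)"
    by (rule has_field_derivative_transform_within[OF _ zero_less_one t]) (simp add: energy_eq_deviations)
  have ends: "force t 1 = 0" "force t (n + 1) = 0"
    by (auto simp: dV_def)
  have "vmax\<^sup>2 / 2 * (2 * \<phi> t i * ?\<phi>' i) = - \<mu> * vmax\<^sup>2 * (\<phi> t i)\<^sup>2 - (v t i - f t i) * ?x i"
    if "i \<in> {1..n}" for i
    unfolding speed_eq_deviation[OF t that] using vmax_pos
    by (simp add: field_simps power2_eq_square)
  hence "?D = (\<Sum>i=1..n. - \<mu> * vmax\<^sup>2 * (\<phi> t i)\<^sup>2 - (v t i - f t i) * ?x i) + (\<Sum>i=1..n. v t i * ?x i)"
    using summation_by_parts_from_zero[of "force t" "v t" n] ends by (simp add: sum_distrib_left)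
  also have "\<dots> = (\<Sum>i=1..n. vstar * ?x i + (- \<mu> * vmax\<^sup>2 * (\<phi> t i)\<^sup>2 - b (?x i) * ?x i))"
    unfolding sum.distrib[symmetric] by (rule sum.cong) (auto simp: f_S_def algebra_simps)
  also have "\<dots> = (\<Sum>i=1..n. vstar * ?x i) + ?E"
    by (simp only: sum.distrib sum_subtractf sum_distrib_left)
  also have "(\<Sum>i=1..n. vstar * ?x i) = 0"
    using summation_by_parts_from_zero[of "force t" "\<lambda>_. vstar" n] ends by simp
  finally show ?thesis using derivative by simp
qed

lemma energy_antimono:
  assumes "a \<in> J" "c \<in> J" "a \<le> c"
  shows "energy c \<le> energy a"
proof (rule nonincreasing_from_deriv_nonpos[OF \<open>a \<le> c\<close>])
  show "(energy has_real_derivative - \<mu> * vmax\<^sup>2 * (\<Sum>i=1..n. (\<phi> t i)\<^sup>2)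
      - (\<Sum>i=1..n. b (force t (i + 1) - force t i) * (force t (i + 1) - force t i))) (at t within {a..c})"
    if "t \<in> {a..c}" for t
    using subinterval[OF assms(1,2)] that
    by (intro has_field_derivative_subset[OF energy_has_derivative]) auto
  have "0 \<le> b x * x" for x
    using b_nonneg[of x] b_nonpos[of x] by (cases "0 \<le> x") (auto intro: mult_nonpos_nonpos)
  thus "- \<mu> * vmax\<^sup>2 * (\<Sum>i=1..n. (\<phi> t i)\<^sup>2)
      - (\<Sum>i=1..n. b (force t (i + 1) - force t i) * (force t (i + 1) - force t i)) \<le> 0" for t
    using mu_pos by (smt (verit) mult_nonneg_nonneg minus_mult_left sum_nonneg zero_le_power2)
qed

lemma deviation_bound:
  assumes t: "t \<in> J" and i: "i \<in> {1..n}"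
  shows "\<bar>\<phi> t i\<bar> \<le> sqrt (2 * energy 0) / vmax"
proof -
  have "(\<phi> t i)\<^sup>2 \<le> (\<Sum>i=1..n. (\<phi> t i)\<^sup>2)"
    using i by (intro member_le_sum) auto
  hence "vmax\<^sup>2 * (\<phi> t i)\<^sup>2 \<le> vmax\<^sup>2 * (\<Sum>i=1..n. (\<phi> t i)\<^sup>2)"
    by (intro mult_left_mono) auto
  moreover have "0 \<le> (\<Sum>i=2..n. V (s t i))"
    using V_nonneg spacing_gt[OF t] by (intro sum_nonneg) auto
  ultimately have "vmax\<^sup>2 * (\<phi> t i)\<^sup>2 \<le> 2 * energy t"
    by (simp add: energy_eq_deviations[OF t])
  also have "\<dots> \<le> 2 * energy 0"
    using energy_antimono[OF J_0 t] J_nonneg t by auto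
  finally have "sqrt ((vmax * \<phi> t i)\<^sup>2) \<le> sqrt (2 * energy 0)"
    by (simp add: power_mult_distrib)
  hence "vmax * \<bar>\<phi> t i\<bar> \<le> sqrt (2 * energy 0)"
    using vmax_pos by (simp add: abs_mult)
  thus ?thesis using vmax_pos by (simp add: field_simps)
qed

section \<open>Growth of a large spacing\<close>

text \<open>
  While \<open>s\<^sub>i\<close> stays beyond the interaction distance, vehicle \<open>i - 1\<close> has no follower to push it
  forward and vehicle \<open>i\<close> no predecessor to hold it back. The deviations can therefore widen the gap
  only with an exponentially decaying speed. The hypothesis on \<open>s\<^sub>i\<close> concerns only
  the interior of the phase, so that \<open>a\<close> may be the last time with \<open>s\<^sub>i \<le> lam\<close>.
\<close>

lemma spacing_growth:
  assumes i: "i \<in> {2..n}" and aJ: "a \<in> J" and cJ: "c \<in> J" and ac: "a \<le> c"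
    and large: "\<And>t. a < t \<Longrightarrow> t < c \<Longrightarrow> lam \<le> s t i"
  shows "s c i \<le> s a i + sqrt (2 * energy 0) / \<mu>"
proof -
  define C where "C = sqrt (2 * energy 0) / vmax"
  have i1: "i \<in> {1..n}" and i0: "i - 1 \<in> {1..n}" and [simp]: "Suc (i - Suc 0) = i"
    using i by auto
  have C: "\<bar>\<phi> t i\<bar> \<le> C" "\<bar>\<phi> t (i - 1)\<bar> \<le> C" if "t \<in> J" for t
    using deviation_bound that i0 i1 by (auto simp: C_def)
  have inJ: "t \<in> J" if "a \<le> t" "t \<le> c" for t
    using subinterval[OF aJ cJ] that by auto
  have free: "force t i = 0" if "a < t" "t < c" for t
    using deriv_V_zero large[OF that] by (simp add: dV_def)
  let ?g = "\<lambda>t j. sqrt (v t j * (vmax - v t j))"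

  have leader: "\<phi> t (i - 1) \<le> exp (- \<mu> * (t - a)) * C" if t: "a \<le> t" "t < c" for t
  proof -
    have "\<phi> t (i - 1) \<le> exp (- \<mu> * (t - a)) * \<phi> a (i - 1)"
    proof (rule exponential_decay[OF \<open>a \<le> t\<close>])
      show "((\<lambda>\<tau>. \<phi> \<tau> (i - 1)) has_real_derivative - \<mu> * \<phi> x (i - 1) +
          ?g x (i - 1) * (force x (i - 1) - force x i) / vmax\<^sup>2) (at x within {a..t})"
        if "x \<in> {a..t}" for x
        using has_field_derivative_subset[OF deviation_has_derivative[OF _ i0]] inJ that t
          subinterval[OF aJ inJ[of t]] by simp
      show "- \<mu> * \<phi> x (i - 1) + ?g x (i - 1) * (force x (i - 1) - force x i) / vmax\<^sup>2
          \<le> - \<mu> * \<phi> x (i - 1)" if "a < x" "x < t" for x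
      proof -
        have x: "x \<in> J" "force x i = 0" using inJ free that t by auto
        thus ?thesis
          using force_nonpos speed_pos[OF x(1) i0] speed_less[OF x(1) i0]
          by (simp add: divide_nonpos_nonneg mult_nonneg_nonpos)
      qed
    qed
    also have "\<dots> \<le> exp (- \<mu> * (t - a)) * C"
      using C[OF aJ] by (intro mult_left_mono) auto
    finally show ?thesis .
  qed
  have follower: "- \<phi> t i \<le> exp (- \<mu> * (t - a)) * C" if t: "a \<le> t" "t < c" for t
  proof -
    have "- \<phi> t i \<le> exp (- \<mu> * (t - a)) * - \<phi> a i"
    proof (rule exponential_decay[OF \<open>a \<le> t\<close>])
      show "((\<lambda>\<tau>. - \<phi> \<tau> i) has_real_derivative - (- \<mu> * \<phi> x i +
          ?g x i * (force x i - force x (i + 1)) / vmax\<^sup>2)) (at x within {a..t})"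
        if "x \<in> {a..t}" for x
        using has_field_derivative_subset[OF deviation_has_derivative[OF _ i1]] inJ that t
          subinterval[OF aJ inJ[of t]] by (intro DERIV_minus) simp
      show "- (- \<mu> * \<phi> x i + ?g x i * (force x i - force x (i + 1)) / vmax\<^sup>2)
          \<le> - \<mu> * - \<phi> x i" if "a < x" "x < t" for x
      proof -
        have x: "x \<in> J" "force x i = 0" using inJ free that t by auto
        thus ?thesis
          using force_nonpos speed_pos[OF x(1) i1] speed_less[OF x(1) i1]
          by (simp add: divide_nonpos_nonneg mult_nonneg_nonpos)
      qed
    qed
    also have "\<dots> \<le> exp (- \<mu> * (t - a)) * C"
      using C[OF aJ] by (intro mult_left_mono) auto
    finally show ?thesis .
  qed

  have rate: "v t (i - 1) - v t i \<le> vmax * C * exp (- \<mu> * (t - a))" if t: "a < t" "t < c" for t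
  proof -
    define E where "E = exp (- \<mu> * (t - a)) * C"
    have tJ: "t \<in> J" using inJ t by simp
    have "0 \<le> C" using C[OF aJ] by linarith
    hence E: "0 \<le> E" by (simp add: E_def)
    have weighted: "?g t j * y \<le> vmax / 2 * E" if "y \<le> E" "j \<in> {1..n}" for j y
    proof -
      have "?g t j * y \<le> ?g t j * E"
        using that speed_pos[OF tJ] speed_less[OF tJ] by (intro mult_left_mono) (auto simp: less_imp_le)
      also have "\<dots> \<le> vmax / 2 * E"
        using E vmax_pos by (intro mult_right_mono sqrt_mult_diff_le_half)
      finally show ?thesis .
    qed
    have "f t (i - 1) \<le> vstar" "vstar \<le> f t i"
      using free[OF t] b_nonneg b_nonpos force_nonpos[OF tJ] by (auto simp: f_S_def)
    hence "v t (i - 1) - v t i \<le> (v t (i - 1) - f t (i - 1)) - (v t i - f t i)"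
      by simp
    also have "\<dots> = ?g t (i - 1) * \<phi> t (i - 1) + ?g t i * (- \<phi> t i)"
      using speed_eq_deviation[OF tJ i0] speed_eq_deviation[OF tJ i1] by simp
    also have "\<dots> \<le> vmax / 2 * E + vmax / 2 * E"
      using t leader[of t] follower[of t] i0 i1 by (intro add_mono weighted) (auto simp: E_def)
    finally show ?thesis by (simp add: E_def algebra_simps)
  qed

  \<comment> \<open>The decaying rate has the primitive \<open>- vmax * C / \<mu> * exp (- \<mu> * (t - a))\<close>.\<close>
  have "s c i + vmax * C / \<mu> * exp (- \<mu> * (c - a)) \<le> s a i + vmax * C / \<mu> * exp (- \<mu> * (a - a))"
  proof (rule nonincreasing_from_deriv_nonpos[OF ac])
    show "((\<lambda>t. s t i + vmax * C / \<mu> * exp (- \<mu> * (t - a))) has_real_derivative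
        v t (i - 1) - v t i - vmax * C * exp (- \<mu> * (t - a))) (at t within {a..c})"
      if "t \<in> {a..c}" for t
    proof -
      have "((\<lambda>\<tau>. s \<tau> i) has_real_derivative v t (i - 1) - v t i) (at t within {a..c})"
        using has_field_derivative_subset[OF spacing_has_derivative[OF _ i]] inJ that
          subinterval[OF aJ cJ] by simp
      thus ?thesis
        using mu_pos by (auto intro!: derivative_eq_intros)
    qed
    show "v t (i - 1) - v t i - vmax * C * exp (- \<mu> * (t - a)) \<le> 0" if "a < t" "t < c" for t
      using rate[OF that] by simp
  qed
  moreover have "0 \<le> C" using C[OF aJ] by linarith
  hence "0 \<le> vmax * C / \<mu> * exp (- \<mu> * (c - a))"
    using vmax_pos mu_pos by simp
  ultimately have "s c i \<le> s a i + vmax * C / \<mu>" by simp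
  thus ?thesis using vmax_pos by (simp add: C_def)
qed

lemma spacing_bound:
  assumes t: "t \<in> J" and i: "i \<in> {2..n}"
  shows "s t i \<le> max (s 0 i) lam + sqrt (2 * energy 0) / \<mu>"
proof -
  have "0 \<le> t" using t J_nonneg by auto
  have inJ: "{0..t} \<subseteq> J" using subinterval[OF J_0 t] .
  \<comment> \<open>The growth phase starts at the last time with \<open>s\<^sub>i \<le> lam\<close> or, failing that, at time \<open>0\<close>.\<close>
  define S where "S = {\<tau> \<in> {0..t}. s \<tau> i \<le> lam}"
  obtain a where a: "0 \<le> a" "a \<le> t" "s a i \<le> max (s 0 i) lam"
    and large: "\<And>\<tau>. a < \<tau> \<Longrightarrow> \<tau> < t \<Longrightarrow> lam \<le> s \<tau> i"
  proof (cases "S = {}")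
    case True
    hence "lam \<le> s \<tau> i" if "0 < \<tau>" "\<tau> < t" for \<tau>
      using that True[unfolded S_def, THEN equals0D, of \<tau>] by simp
    thus ?thesis using that[of 0] \<open>0 \<le> t\<close> by auto
  next
    case False
    have "continuous_on J (\<lambda>\<tau>. s \<tau> i)"
      using spacing_has_derivative[OF _ i] by (rule DERIV_continuous_on)
    hence "continuous_on {0..t} (\<lambda>\<tau>. s \<tau> i)"
      using inJ continuous_on_subset by blast
    hence "closed S"
      unfolding S_def by (intro continuous_on_closed_Collect_le) auto
    moreover have "bounded S"
      by (rule bounded_subset[of "{0..t}"]) (auto simp: S_def)
    ultimately have "compact S"
      by (simp add: compact_eq_bounded_closed)
    then obtain a where a: "a \<in> S" "\<And>\<tau>. \<tau> \<in> S \<Longrightarrow> \<tau> \<le> a"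
      using compact_attains_sup[OF _ False] by blast
    have "lam \<le> s \<tau> i" if "a < \<tau>" "\<tau> < t" for \<tau>
      using that a(1) a(2)[of \<tau>] by (cases "s \<tau> i \<le> lam") (auto simp: S_def)
    thus ?thesis using that[of a] a(1) by (auto simp: S_def)
  qed
  moreover have "a \<in> J" using a inJ by auto
  ultimately show ?thesis using spacing_growth[OF i _ t] by force
qed

end

section \<open>The bound on the spacings\<close>


theorem proposition2:
  fixes n :: nat and L lam vmax vstar \<mu> :: real
    and V b :: "real \<Rightarrow> real"
    and J :: "real set"
    and s v :: "real \<Rightarrow> nat \<Rightarrow> real"
  assumes "2 \<le> n"
    and "0 < L" and "L < lam"
    and "0 < vmax" and "0 < vstar" and "vstar < vmax"
    and "0 < \<mu>"
    and "Ck_on 3 V {L<..}"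
    and "\<And>x. L < x \<Longrightarrow> 0 \<le> V x"
    and "filterlim V at_top (at_right L)"
    and "\<And>x. lam \<le> x \<Longrightarrow> V x = 0"
    and "\<And>x. L < x \<Longrightarrow> x < lam \<Longrightarrow> deriv V x < 0"
    and "\<And>x. L < x \<Longrightarrow> x < lam \<Longrightarrow> deriv (deriv V) x > 0"
    and "Ck_on 2 b UNIV"
    and "\<And>x. b x \<in> {vstar - vmax<..<vstar}"
    and "mono b"
    and "b 0 = 0"
    and "\<And>x. x \<noteq> 0 \<Longrightarrow> 0 < x * b x"
    and "0 < deriv b 0"
    and "is_interval J" and "0 \<in> J" and "J \<subseteq> {0..}"
    and "open_road_solution n L V b vstar vmax \<mu> J s v"
  shows "\<forall>t\<in>J. \<forall>i\<in>{2..n}.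
    s t i \<le> max (s 0 i) lam
      + vmax * sqrt (2 * H_S n V b vstar vmax (s 0) (v 0)) / (2 * \<mu> * min vstar (vmax - vstar))"
proof (intro ballI)
  fix t i
  assume t: "t \<in> J" and i: "i \<in> {2..n}"
  have "b differentiable at x" for x
    using \<open>Ck_on 2 b UNIV\<close> unfolding Ck_on_def differentiable_on_def
    by (metis UNIV_I funpow_0 pos2)
  moreover have "Ck_on 2 V {L<..}"
    using \<open>Ck_on 3 V {L<..}\<close> by (auto simp: Ck_on_def)
  ultimately interpret open_road n L lam vmax vstar \<mu> V b J s v
    using assms by unfold_locales
  let ?r = "sqrt (2 * energy 0)"
  have m: "0 < min vstar (vmax - vstar)" "2 * min vstar (vmax - vstar) \<le> vmax"
    using \<open>0 < vstar\<close> \<open>vstar < vmax\<close> by (auto simp: min_def)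
  have "0 \<le> ?r / vmax"
    using deviation_bound[OF J_0, of i] i by (auto intro: order_trans[OF abs_ge_zero])
  hence "0 \<le> ?r / \<mu>"
    using \<open>0 < vmax\<close> \<open>0 < \<mu>\<close> by (simp add: field_simps)
  \<comment> \<open>\<open>vmax / (2 * min vstar (vmax - vstar)) \<ge> 1\<close>, so the bound through \<open>?r / \<mu>\<close> suffices.\<close>
  hence "1 * (?r / \<mu>) \<le> vmax / (2 * min vstar (vmax - vstar)) * (?r / \<mu>)"
    using m by (intro mult_right_mono) (simp_all add: field_simps)
  also have "\<dots> = vmax * ?r / (2 * \<mu> * min vstar (vmax - vstar))"
    by simp
  finally show "s t i \<le> max (s 0 i) lam
      + vmax * ?r / (2 * \<mu> * min vstar (vmax - vstar))"
    using spacing_bound[OF t i] by simp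
qed

end
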